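(* Let $I,J\subset\mathbb{R}$ be nonempty open intervals and let $\alpha:I\to\mathbb{R}^3$ be a smooth curve parameterized by arc length with nowhere vanishing curvature, with Frenet frame $t,n,b$. (1) If the normal surface $r:I\times J\to\mathbb{R}^3$, $r(s,v)=\alpha(s)+v\,n(s)$, is regular and is a constant angle surface, then it is a piece of a plane, i.e. $r(I\times J)$ is contained in a plane. (2) If the binormal surface $r:I\times J\to\mathbb{R}^3$, $r(s,v)=\alpha(s)+v\,b(s)$, is a constant angle surface, then it is a piece of a cylindrical surface, i.e. up to an isometry of $\mathbb{R}^3$, $r(I\times J)$ is contained in $\beta\times\mathbb{R}$ for some smooth regular plane curve $\beta$ in $\mathbb{R}^2$, with the rulings $v\mapsto r(s,v)$ contained in the lines $\{q\}\times\mathbb{R}$, $q\in\beta$.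
   Context: Smooth means $C^\infty$. The Frenet frame of $\alpha$ is $t=\alpha'$, $n=\alpha''/|\alpha''|$, $b=t\times n$. Constant angle surface: a regular parameterized surface (smooth immersion) $r:I\times J\to\mathbb{R}^3$ with smooth unit normal field $N=\pm\frac{r_s\times r_v}{|r_s\times r_v|}$ is a constant angle surface if there are a fixed unit vector $k\in\mathbb{R}^3$ and a constant $\theta\in[0,\pi)$ such that $N$ makes the angle $\theta$ with $k$ at every point, i.e. $\langle N,k\rangle=\cos\theta$ on $I\times J$ (for some choice of the sign of $N$). *)

theory Defs
  imports "HOL-Analysis.Analysis"
begin

definition open_interval :: "real set \<Rightarrow> bool" where
  "open_interval I \<longleftrightarrow> open I \<and> is_interval I \<and> I \<noteq> {}"

(* The class C^k in terms of iterated directional derivatives, for open S in finite dimension. *)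
primrec Ck_on :: "nat \<Rightarrow> 'a::euclidean_space set \<Rightarrow> ('a \<Rightarrow> 'b::real_normed_vector) \<Rightarrow> bool" where
  "Ck_on 0 S f \<longleftrightarrow> continuous_on S f"
| "Ck_on (Suc k) S f \<longleftrightarrow>
     (\<forall>x\<in>S. f differentiable (at x)) \<and>
     (\<forall>h. Ck_on k S (\<lambda>x. frechet_derivative f (at x) h))"

definition smooth_on :: "'a::euclidean_space set \<Rightarrow> ('a \<Rightarrow> 'b::real_normed_vector) \<Rightarrow> bool" where
  "smooth_on S f \<longleftrightarrow> (\<forall>k. Ck_on k S f)"

definition velocity :: "(real \<Rightarrow> 'a::real_normed_vector) \<Rightarrow> real \<Rightarrow> 'a" where
  "velocity \<alpha> s = vector_derivative \<alpha> (at s)"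

definition acceleration :: "(real \<Rightarrow> 'a::real_normed_vector) \<Rightarrow> real \<Rightarrow> 'a" where
  "acceleration \<alpha> = velocity (velocity \<alpha>)"

(* The curvature and frame below are those of a curve parameterized by arc length. *)
definition curvature :: "(real \<Rightarrow> real^3) \<Rightarrow> real \<Rightarrow> real" where
  "curvature \<alpha> s = norm (acceleration \<alpha> s)"

definition frenet_t :: "(real \<Rightarrow> real^3) \<Rightarrow> real \<Rightarrow> real^3" where
  "frenet_t \<alpha> s = velocity \<alpha> s"

definition frenet_n :: "(real \<Rightarrow> real^3) \<Rightarrow> real \<Rightarrow> real^3" where
  "frenet_n \<alpha> s = acceleration \<alpha> s /\<^sub>R norm (acceleration \<alpha> s)"

definition frenet_b :: "(real \<Rightarrow> real^3) \<Rightarrow> real \<Rightarrow> real^3" where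
  "frenet_b \<alpha> s = cross3 (frenet_t \<alpha> s) (frenet_n \<alpha> s)"

definition normal_surface :: "(real \<Rightarrow> real^3) \<Rightarrow> real \<times> real \<Rightarrow> real^3" where
  "normal_surface \<alpha> = (\<lambda>(s, v). \<alpha> s + v *\<^sub>R frenet_n \<alpha> s)"

definition binormal_surface :: "(real \<Rightarrow> real^3) \<Rightarrow> real \<times> real \<Rightarrow> real^3" where
  "binormal_surface \<alpha> = (\<lambda>(s, v). \<alpha> s + v *\<^sub>R frenet_b \<alpha> s)"

definition surface_normal :: "(real \<times> real \<Rightarrow> real^3) \<Rightarrow> real \<times> real \<Rightarrow> real^3" where
  "surface_normal r = (\<lambda>(s, v).
     cross3 (vector_derivative (\<lambda>x. r (x, v)) (at s)) (vector_derivative (\<lambda>y. r (s, y)) (at v)))"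

definition regular_surface :: "real set \<Rightarrow> real set \<Rightarrow> (real \<times> real \<Rightarrow> real^3) \<Rightarrow> bool" where
  "regular_surface I J r \<longleftrightarrow>
     smooth_on (I \<times> J) r \<and> (\<forall>p \<in> I \<times> J. surface_normal r p \<noteq> 0)"

(* On a connected domain, smoothness of N forces the same sign at all points. *)
definition smooth_unit_normal ::
  "real set \<Rightarrow> real set \<Rightarrow> (real \<times> real \<Rightarrow> real^3) \<Rightarrow> (real \<times> real \<Rightarrow> real^3) \<Rightarrow> bool" where
  "smooth_unit_normal I J r N \<longleftrightarrow>
     smooth_on (I \<times> J) N \<and>
     (\<forall>p \<in> I \<times> J. N p = surface_normal r p /\<^sub>R norm (surface_normal r p) \<or>
                   N p = - (surface_normal r p /\<^sub>R norm (surface_normal r p)))"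

definition constant_angle_surface :: "real set \<Rightarrow> real set \<Rightarrow> (real \<times> real \<Rightarrow> real^3) \<Rightarrow> bool" where
  "constant_angle_surface I J r \<longleftrightarrow>
     regular_surface I J r \<and>
     (\<exists>N k \<theta>. smooth_unit_normal I J r N \<and> norm k = 1 \<and> 0 \<le> \<theta> \<and> \<theta> < pi \<and>
        (\<forall>p \<in> I \<times> J. N p \<bullet> k = cos \<theta>))"

definition piece_of_plane :: "real set \<Rightarrow> real set \<Rightarrow> (real \<times> real \<Rightarrow> real^3) \<Rightarrow> bool" where
  "piece_of_plane I J r \<longleftrightarrow> (\<exists>a c. a \<noteq> 0 \<and> r ` (I \<times> J) \<subseteq> {x. a \<bullet> x = c})"

definition regular_plane_curve :: "real set \<Rightarrow> (real \<Rightarrow> real^2) \<Rightarrow> bool" where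
  "regular_plane_curve K \<beta> \<longleftrightarrow>
     open_interval K \<and> smooth_on K \<beta> \<and> (\<forall>u \<in> K. velocity \<beta> u \<noteq> 0)"

(* The line {q} x R under the identification of R^2 x R with R^3. *)
definition vertical_line :: "real^2 \<Rightarrow> (real^3) set" where
  "vertical_line q = {vector [q $ 1, q $ 2, h] | h. True}"

definition isometry_of_space :: "(real^3 \<Rightarrow> real^3) \<Rightarrow> bool" where
  "isometry_of_space F \<longleftrightarrow> bij F \<and> (\<forall>x y. dist (F x) (F y) = dist x y)"

definition piece_of_cylindrical_surface ::
  "real set \<Rightarrow> real set \<Rightarrow> (real \<times> real \<Rightarrow> real^3) \<Rightarrow> bool" where
  "piece_of_cylindrical_surface I J r \<longleftrightarrow>
     (\<exists>F K \<beta>. isometry_of_space F \<and> regular_plane_curve K \<beta> \<and>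
        F ` r ` (I \<times> J) \<subseteq> (\<Union>q \<in> \<beta> ` K. vertical_line q) \<and>
        (\<forall>s \<in> I. \<exists>q \<in> \<beta> ` K. \<forall>v \<in> J. F (r (s, v)) \<in> vertical_line q))"

end

theory Submission
  imports Defs
begin

text \<open>
  The angle condition is a condition on the torsion. Write \<open>M\<close> for the cross product of the two
  partial derivatives of the ruled surface and \<open>k\<close>, \<open>\<theta>\<close> for the axis and the angle. The Frenet
  equations express \<open>M\<close> as a combination of the frame with coefficients affine in \<open>v\<close>:
  it is \<open>(1 - v \<kappa>) b - v \<tau> t\<close> for the normal surface and \<open>- n - v \<tau> t\<close> for the binormal surface.
  The condition \<open>(M \<bullet> k)\<^sup>2 = cos\<^sup>2 \<theta> |M|\<^sup>2\<close>, in which the sign of the unit normal no longer appears,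
  is then for fixed \<open>s\<close> a polynomial identity of degree two in \<open>v\<close> on an open interval, so its three
  coefficients can be compared.

  Let \<open>w\<close> be \<open>b\<close> for the normal surface and \<open>n\<close> for the binormal surface. In both cases
  the comparison gives \<open>(w \<bullet> k)\<^sup>2 = cos\<^sup>2 \<theta>\<close> everywhere and, at a point with \<open>\<tau> \<noteq> 0\<close>, also
  \<open>(t \<bullet> k)\<^sup>2 = cos\<^sup>2 \<theta>\<close> and \<open>(w \<bullet> k) (t \<bullet> k) = 0\<close>. Such a point therefore forces \<open>cos \<theta> = 0\<close>.
  Then \<open>w \<bullet> k\<close> vanishes on the whole curve, and its derivative at the given point makes the third frame
  vector orthogonal to \<open>k\<close> too. So \<open>k = 0\<close>, which is absurd: the torsion vanishes identically
  (\<open>normal_surface_torsion_free\<close>, \<open>binormal_surface_torsion_free\<close>).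

  Hence \<open>b\<close> is a constant vector. The curve and its principal normals lie in one plane orthogonal to
  \<open>b\<close>, which settles the normal surface; the binormal lines are all parallel to \<open>b\<close>, so that the
  binormal surface is a cylinder over the projection of \<open>\<alpha>\<close> to that plane
  (\<open>piece_of_plane_normal_surface\<close>, \<open>piece_of_cylindrical_surface_binormal_surface\<close>).
\<close>

section \<open>Smooth maps\<close>

text \<open>Differentiability at a point of an open set, and the derivative there, depend only on the values
  in that set; this allows derivatives to be replaced by formulas that hold on \<open>S\<close> only.\<close>
lemma Ck_on_cong:
  assumes "open S" and "\<And>x. x \<in> S \<Longrightarrow> f x = g x" and "Ck_on k S f"
  shows "Ck_on k S g"
  using assms(2,3)
proof (induction k arbitrary: f g)
  case 0
  then show ?case using continuous_on_cong[of S S f g] by simp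
next
  case (Suc k)
  have diff: "f differentiable (at x)" if "x \<in> S" for x
    using Suc.prems(2) that by simp
  have g_der: "(g has_derivative frechet_derivative f (at x)) (at x)" if "x \<in> S" for x
    using has_derivative_transform_within_open[of f "frechet_derivative f (at x)" x UNIV S g]
      diff[OF that] that assms(1) Suc.prems(1) by (simp add: frechet_derivative_works)
  have "frechet_derivative f (at x) h = frechet_derivative g (at x) h" if "x \<in> S" for x h
    using frechet_derivative_at[OF g_der[OF that]] by simp
  then have "Ck_on k S (\<lambda>x. frechet_derivative g (at x) h)" for h
    using Suc.IH[of "\<lambda>x. frechet_derivative f (at x) h"] Suc.prems(2) by simp
  then show ?case using g_der by (auto simp: differentiable_def)
qed

lemma Ck_on_bounded_linear_compose:
  assumes "open S" and "bounded_linear L" and "Ck_on k S f"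
  shows "Ck_on k S (\<lambda>x. L (f x))"
  using assms(3)
proof (induction k arbitrary: f)
  case 0
  then show ?case
    using bounded_linear.continuous_on[OF assms(2)] by simp
next
  case (Suc k)
  have der: "((\<lambda>x. L (f x)) has_derivative (\<lambda>h. L (frechet_derivative f (at x) h))) (at x)"
    if "x \<in> S" for x
    by (rule bounded_linear.has_derivative[OF assms(2)])
      (use Suc.prems that in \<open>simp flip: frechet_derivative_works\<close>)
  have "Ck_on k S (\<lambda>x. frechet_derivative (\<lambda>x. L (f x)) (at x) h)" for h
  proof (rule Ck_on_cong[OF assms(1)])
    show "Ck_on k S (\<lambda>x. L (frechet_derivative f (at x) h))"
      using Suc by simp
    show "L (frechet_derivative f (at x) h) = frechet_derivative (\<lambda>x. L (f x)) (at x) h"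
      if "x \<in> S" for x
      using frechet_derivative_at[OF der[OF that]] by metis
  qed
  then show ?case using der by (auto simp: differentiable_def)
qed

lemma smooth_on_bounded_linear_compose:
  "open S \<Longrightarrow> bounded_linear L \<Longrightarrow> smooth_on S f \<Longrightarrow> smooth_on S (\<lambda>x. L (f x))"
  unfolding smooth_on_def using Ck_on_bounded_linear_compose by blast

lemma smooth_on_has_velocity:
  fixes f :: "real \<Rightarrow> 'a::real_normed_vector"
  assumes "smooth_on S f" and "s \<in> S"
  shows "(f has_vector_derivative velocity f s) (at s)"
proof -
  have "Ck_on (Suc 0) S f" using assms(1) smooth_on_def by blast
  then show ?thesis using assms(2) by (simp add: vector_derivative_works velocity_def)
qed

lemma smooth_on_velocity:
  fixes f :: "real \<Rightarrow> 'a::real_normed_vector"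
  assumes "open S" and "smooth_on S f"
  shows "smooth_on S (velocity f)"
  unfolding smooth_on_def
proof
  fix k
  have C: "Ck_on (Suc k) S f" using assms(2) smooth_on_def by blast
  show "Ck_on k S (velocity f)"
  proof (rule Ck_on_cong[OF assms(1)])
    show "Ck_on k S (\<lambda>x. frechet_derivative f (at x) 1)" using C by simp
    show "frechet_derivative f (at x) 1 = velocity f x" if "x \<in> S" for x
      using frechet_derivative_at[OF smooth_on_has_velocity[OF assms(2) that,
            unfolded has_vector_derivative_def]] by (metis scaleR_one)
  qed
qed

text \<open>The product rule for a constant inner product. It yields the coefficients of the Frenet equations
  from orthonormality of the frame, and it differentiates relations such as \<open>b \<bullet> k = 0\<close>.\<close>
lemma inner_constant_derivative:
  fixes f g :: "real \<Rightarrow> 'a::real_inner"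
  assumes "open S" and "s \<in> S"
    and "(f has_vector_derivative f') (at s)" and "(g has_vector_derivative g') (at s)"
    and const: "\<And>x. x \<in> S \<Longrightarrow> f x \<bullet> g x = c"
  shows "f' \<bullet> g s + f s \<bullet> g' = 0"
proof -
  have "((\<lambda>x. f x \<bullet> g x) has_vector_derivative (f s \<bullet> g' + f' \<bullet> g s)) (at s)"
    by (rule bounded_bilinear.has_vector_derivative[OF bounded_bilinear_inner assms(3,4)])
  moreover have "((\<lambda>x. f x \<bullet> g x) has_vector_derivative 0) (at s)"
    by (rule has_vector_derivative_transform_within_open[of "\<lambda>x. c" _ s S])
      (use assms in auto)
  ultimately show ?thesis
    using vector_derivative_unique_at by fastforce
qed

lemma has_vector_derivative_zero_constant_on:
  fixes f :: "real \<Rightarrow> 'a::real_normed_vector"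
  assumes "is_interval S" and "\<And>s. s \<in> S \<Longrightarrow> (f has_vector_derivative 0) (at s)"
    and "x \<in> S" and "y \<in> S"
  shows "f x = f y"
proof -
  have "\<exists>c. \<forall>s\<in>S. f s = c"
    using has_vector_derivative_zero_constant[of S f] assms(1,2) is_interval_convex
      has_vector_derivative_at_within by metis
  then show ?thesis using assms by auto
qed

section \<open>Orthonormal frames of space\<close>

locale orthonormal_frame =
  fixes t n b :: "real^3"
  assumes tt: "t \<bullet> t = 1" and nn: "n \<bullet> n = 1" and tn: "t \<bullet> n = 0" and b: "b = cross3 t n"
begin

lemma nt: "n \<bullet> t = 0"
  and tb: "t \<bullet> b = 0" and bt: "b \<bullet> t = 0"
  and nb: "n \<bullet> b = 0" and bn: "b \<bullet> n = 0"
  using tn by (simp_all add: b dot_cross_self inner_commute)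

lemma bb: "b \<bullet> b = 1"
  using norm_cross_dot[of t n] tt nn tn
  by (simp add: b norm_eq_1 power2_norm_eq_inner power_mult_distrib)

lemma cross_nb: "cross3 n b = t" and cross_bn: "cross3 b n = - t"
  and cross_tb: "cross3 t b = - n" and cross_bt: "cross3 b t = n"
  using tt nn tn nt by (simp_all add: b Lagrange cross_skew[of "cross3 t n"])

lemmas frame_inner = tt nn bb tn nt tb bt nb bn
lemmas frame_cross = b[symmetric] cross_nb cross_bn cross_tb cross_bt

text \<open>A vector orthogonal to \<open>t\<close> and \<open>n\<close> is parallel to \<open>t \<times> n\<close>, by Lagrange's formula for the
  triple product; if it is also orthogonal to \<open>t \<times> n\<close>, it is zero.\<close>
lemma eq_0_if_orthogonal:
  assumes "t \<bullet> x = 0" and "n \<bullet> x = 0" and "b \<bullet> x = 0"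
  shows "x = 0"
proof -
  have "cross3 x b = 0" using assms by (simp add: b Lagrange inner_commute)
  then show ?thesis
    using norm_and_cross_eq_0[of x b] assms bb by (auto simp: inner_commute)
qed

lemma expansion: "x = (t \<bullet> x) *\<^sub>R t + (n \<bullet> x) *\<^sub>R n + (b \<bullet> x) *\<^sub>R b"
proof -
  have "x - ((t \<bullet> x) *\<^sub>R t + (n \<bullet> x) *\<^sub>R n + (b \<bullet> x) *\<^sub>R b) = 0"
    by (rule eq_0_if_orthogonal) (simp_all add: inner_diff_right inner_add_right frame_inner)
  then show ?thesis by simp
qed

definition coordinates :: "real^3 \<Rightarrow> real^3" where
  "coordinates x = vector [t \<bullet> x, n \<bullet> x, b \<bullet> x]"

lemma isometry_coordinates: "isometry_of_space coordinates"
proof -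
  have "linear coordinates"
    by (rule linearI) (simp_all add: coordinates_def vec_eq_iff forall_3 inner_add_right)
  moreover have "norm (coordinates x) = norm x" for x
  proof -
    have "x \<bullet> x = ((t \<bullet> x) *\<^sub>R t + (n \<bullet> x) *\<^sub>R n + (b \<bullet> x) *\<^sub>R b) \<bullet> x"
      using expansion[of x] by simp
    also have "\<dots> = (t \<bullet> x)\<^sup>2 + (n \<bullet> x)\<^sup>2 + (b \<bullet> x)\<^sup>2"
      by (simp add: inner_add_left power2_eq_square)
    also have "\<dots> = coordinates x \<bullet> coordinates x"
      unfolding coordinates_def inner_vec_def[of "vector _"] by (simp add: sum_3 power2_eq_square)
    finally show ?thesis by (simp add: norm_eq_sqrt_inner)
  qed
  ultimately have "orthogonal_transformation coordinates"
    by (simp add: orthogonal_transformation)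
  then show ?thesis
    by (simp add: isometry_of_space_def orthogonal_transformation_bij
        orthogonal_transformation_isometry)
qed

end

section \<open>Frenet equations\<close>

locale frenet_curve =
  fixes I :: "real set" and \<alpha> :: "real \<Rightarrow> real^3"
  assumes I: "open_interval I" and smooth: "smooth_on I \<alpha>"
    and unit_speed: "\<And>s. s \<in> I \<Longrightarrow> norm (velocity \<alpha> s) = 1"
    and curved: "\<And>s. s \<in> I \<Longrightarrow> curvature \<alpha> s \<noteq> 0"
begin

abbreviation "t \<equiv> frenet_t \<alpha>"
abbreviation "n \<equiv> frenet_n \<alpha>"
abbreviation "b \<equiv> frenet_b \<alpha>"
abbreviation "\<kappa> \<equiv> curvature \<alpha>"

text \<open>The torsion, with the sign convention in which \<open>n' = - \<kappa> t + \<tau> b\<close>.\<close>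
definition \<tau> :: "real \<Rightarrow> real" where
  "\<tau> s = velocity n s \<bullet> b s"

lemma open_I: "open I" and interval_I: "is_interval I" and nonempty_I: "I \<noteq> {}"
  using I by (auto simp: open_interval_def)

lemma acceleration_eq: "acceleration \<alpha> s = \<kappa> s *\<^sub>R n s" if "s \<in> I"
  using curved[OF that] by (simp add: curvature_def frenet_n_def)

lemma curve_derivative: "(\<alpha> has_vector_derivative t s) (at s)" if "s \<in> I"
  using smooth_on_has_velocity[OF smooth that] by (simp add: frenet_t_def)

lemma tangent_derivative: "(t has_vector_derivative \<kappa> s *\<^sub>R n s) (at s)" if "s \<in> I"
  using smooth_on_has_velocity[OF smooth_on_velocity[OF open_I smooth] that]
    acceleration_eq[OF that]
  by (simp add: acceleration_def frenet_t_def[abs_def])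

text \<open>Dividing by the curvature keeps \<open>\<alpha>''\<close> differentiable, as the norm is differentiable away from
  the origin.\<close>
lemma normal_has_velocity: "(n has_vector_derivative velocity n s) (at s)" if "s \<in> I"
proof -
  have a: "acceleration \<alpha> differentiable (at s)"
    using smooth_on_has_velocity[OF smooth_on_velocity[OF open_I
        smooth_on_velocity[OF open_I smooth]] that]
    by (metis acceleration_def differentiableI_vector)
  have nz: "acceleration \<alpha> s \<noteq> 0" using curved[OF that] by (simp add: curvature_def)
  have "(\<lambda>s. norm (acceleration \<alpha> s)) differentiable (at s)"
    using differentiable_compose[OF differentiable_norm_at[OF nz] a] by simp
  then have "n differentiable (at s)"
    unfolding frenet_n_def[abs_def] using a nz by (intro differentiable_scaleR differentiable_inverse) auto
  then show ?thesis by (simp add: velocity_def vector_derivative_works)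
qed

lemma frame: "orthonormal_frame (t s) (n s) (b s)" if "s \<in> I"
proof
  have tt: "t x \<bullet> t x = 1" if "x \<in> I" for x
    using unit_speed[OF that] by (simp add: frenet_t_def norm_eq_1)
  show "t s \<bullet> t s = 1" using tt that .
  show "n s \<bullet> n s = 1" using curved[OF that]
    by (simp add: frenet_n_def curvature_def norm_eq_1[symmetric] del: inner_scaleR_left inner_scaleR_right)
  \<comment> \<open>Unit speed makes the acceleration orthogonal to the tangent.\<close>
  show "t s \<bullet> n s = 0"
    using inner_constant_derivative[OF open_I that tangent_derivative[OF that]
        tangent_derivative[OF that] tt] curved[OF that] by (simp add: inner_commute)
  show "b s = cross3 (t s) (n s)" by (simp add: frenet_b_def)
qed

lemmas frame_inner = orthonormal_frame.frame_inner[OF frame]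
lemmas frame_cross = orthonormal_frame.frame_cross[OF frame]

text \<open>Orthonormality determines two components of \<open>n'\<close>: the one along \<open>n\<close> from \<open>n \<bullet> n = 1\<close>, the one
  along \<open>t\<close> from \<open>t \<bullet> n = 0\<close>. The third is the torsion by definition.\<close>
lemma normal_derivative:
  "(n has_vector_derivative - \<kappa> s *\<^sub>R t s + \<tau> s *\<^sub>R b s) (at s)" if s: "s \<in> I"
proof -
  note n' = normal_has_velocity[OF s]
  have "n s \<bullet> velocity n s = 0"
    using inner_constant_derivative[OF open_I s n' n'] frame_inner(2)
    by (simp add: inner_commute)
  moreover have "t s \<bullet> velocity n s = - \<kappa> s"
    using inner_constant_derivative[OF open_I s tangent_derivative[OF s] n' frame_inner(4)]
      frame_inner(2)[OF s] by simp
  ultimately have "velocity n s = - \<kappa> s *\<^sub>R t s + \<tau> s *\<^sub>R b s"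
    using orthonormal_frame.expansion[OF frame[OF s], of "velocity n s"]
    by (simp add: \<tau>_def inner_commute)
  then show ?thesis using n' by simp
qed

lemma binormal_derivative: "(b has_vector_derivative - \<tau> s *\<^sub>R n s) (at s)" if s: "s \<in> I"
proof -
  have "(b has_vector_derivative
      cross3 (t s) (- \<kappa> s *\<^sub>R t s + \<tau> s *\<^sub>R b s) + cross3 (\<kappa> s *\<^sub>R n s) (n s)) (at s)"
    unfolding frenet_b_def[abs_def]
    using bounded_bilinear.has_vector_derivative[OF bilinear_conv_bounded_bilinear[THEN iffD1,
          OF bilinear_cross] tangent_derivative[OF s] normal_derivative[OF s]]
    by (simp add: frenet_b_def)
  then show ?thesis
    by (simp add: cross_add_right Cross3.right_diff_distrib cross_mult_left cross_mult_right frame_cross[OF s])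
qed

lemma binormal_constant_if_torsion_free:
  assumes "\<And>s. s \<in> I \<Longrightarrow> \<tau> s = 0" and "x \<in> I" and "y \<in> I"
  shows "b x = b y"
proof (rule has_vector_derivative_zero_constant_on[OF interval_I])
  show "(b has_vector_derivative 0) (at s)" if "s \<in> I" for s
    using binormal_derivative[OF that] assms(1)[OF that] by simp
qed fact+

section \<open>Normals of the two ruled surfaces\<close>

lemma surface_normal_normal_surface:
  assumes s: "s \<in> I"
  shows "surface_normal (normal_surface \<alpha>) (s, v) = (1 - v * \<kappa> s) *\<^sub>R b s - (v * \<tau> s) *\<^sub>R t s"
proof -
  have "((\<lambda>x. \<alpha> x + v *\<^sub>R n x) has_vector_derivative
      t s + v *\<^sub>R (- \<kappa> s *\<^sub>R t s + \<tau> s *\<^sub>R b s)) (at s)"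
    by (intro has_vector_derivative_add curve_derivative[OF s]
        bounded_linear.has_vector_derivative[OF bounded_linear_scaleR_right]
        normal_derivative[OF s])
  moreover have "((\<lambda>y. \<alpha> s + y *\<^sub>R n s) has_vector_derivative n s) (at v)"
    by (auto intro!: derivative_eq_intros)
  ultimately show ?thesis
    by (simp add: surface_normal_def normal_surface_def vector_derivative_at
        cross_add_left Cross3.left_diff_distrib cross_mult_left frame_cross[OF s] algebra_simps)
qed

lemma surface_normal_binormal_surface:
  assumes s: "s \<in> I"
  shows "surface_normal (binormal_surface \<alpha>) (s, v) = - n s - (v * \<tau> s) *\<^sub>R t s"
proof -
  have "((\<lambda>x. \<alpha> x + v *\<^sub>R b x) has_vector_derivative t s + v *\<^sub>R (- \<tau> s *\<^sub>R n s)) (at s)"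
    by (intro has_vector_derivative_add curve_derivative[OF s]
        bounded_linear.has_vector_derivative[OF bounded_linear_scaleR_right]
        binormal_derivative[OF s])
  moreover have "((\<lambda>y. \<alpha> s + y *\<^sub>R b s) has_vector_derivative b s) (at v)"
    by (auto intro!: derivative_eq_intros)
  ultimately show ?thesis
    by (simp add: surface_normal_def binormal_surface_def vector_derivative_at
        cross_add_left Cross3.left_diff_distrib cross_mult_left frame_cross[OF s] algebra_simps)
qed

end

section \<open>Constant angle forces zero torsion\<close>

lemma quadratic_eq_0_on_open:
  fixes p q r :: real
  assumes "open J" and "J \<noteq> {}" and "\<And>v. v \<in> J \<Longrightarrow> p + q * v + r * v\<^sup>2 = 0"
  shows "p = 0 \<and> q = 0 \<and> r = 0"
proof -
  have "J \<subseteq> {v. poly [:p, q, r:] v = 0}"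
    using assms(3) by (auto simp: algebra_simps power2_eq_square)
  moreover have "infinite J"
    using assms(1,2) finite_imp_not_open by blast
  ultimately have "[:p, q, r:] = 0"
    using poly_roots_finite finite_subset by metis
  then show ?thesis by simp
qed

text \<open>Squaring removes both the choice of sign of the unit normal and the square root in its
  denominator, which leaves a condition polynomial in the partial derivatives.\<close>
lemma constant_angle_surface_square:
  assumes "constant_angle_surface I J r"
  obtains k c where "norm k = 1"
    and "\<And>p. p \<in> I \<times> J \<Longrightarrow>
      (surface_normal r p \<bullet> k)\<^sup>2 = c\<^sup>2 * (surface_normal r p \<bullet> surface_normal r p)"
proof -
  obtain N k \<theta> where N: "smooth_unit_normal I J r N" and k: "norm k = 1"
    and angle: "\<And>p. p \<in> I \<times> J \<Longrightarrow> N p \<bullet> k = cos \<theta>"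
    and reg: "\<And>p. p \<in> I \<times> J \<Longrightarrow> surface_normal r p \<noteq> 0"
    using assms unfolding constant_angle_surface_def regular_surface_def by auto
  have "(surface_normal r p \<bullet> k)\<^sup>2 = (cos \<theta>)\<^sup>2 * (surface_normal r p \<bullet> surface_normal r p)"
    if p: "p \<in> I \<times> J" for p
  proof -
    let ?M = "surface_normal r p"
    have "N p = ?M /\<^sub>R norm ?M \<or> N p = - (?M /\<^sub>R norm ?M)"
      using N p unfolding smooth_unit_normal_def by blast
    then have "(N p \<bullet> k)\<^sup>2 = (?M \<bullet> k)\<^sup>2 / (norm ?M)\<^sup>2"
      by (auto simp: power_mult_distrib divide_inverse power_inverse mult.commute)
    then show ?thesis
      using angle[OF p] reg[OF p] by (simp add: field_simps power2_norm_eq_inner)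
  qed
  then show ?thesis using that k by blast
qed

context frenet_curve
begin

lemma not_orthogonal_to_frame:
  assumes "s \<in> I" and "norm k = 1" and "t s \<bullet> k = 0" and "n s \<bullet> k = 0" and "b s \<bullet> k = 0"
  shows False
  using orthonormal_frame.eq_0_if_orthogonal[OF frame[OF assms(1)] assms(3-5)] assms(2) by simp

text \<open>A point of nonzero torsion forces the angle to be right, so that \<open>b \<bullet> k\<close> vanishes along the
  whole curve; then \<open>b' = - \<tau> n\<close> makes \<open>n\<close> orthogonal to \<open>k\<close> at that point, as \<open>t\<close> and \<open>b\<close> already
  are.\<close>
lemma normal_surface_torsion_free:
  assumes J: "open_interval J" and "constant_angle_surface I J (normal_surface \<alpha>)" and s: "s \<in> I"
  shows "\<tau> s = 0"
proof (rule ccontr)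
  assume torsion: "\<tau> s \<noteq> 0"
  obtain k c where k: "norm k = 1"
    and sq: "\<And>p. p \<in> I \<times> J \<Longrightarrow> (surface_normal (normal_surface \<alpha>) p \<bullet> k)\<^sup>2
      = c\<^sup>2 * (surface_normal (normal_surface \<alpha>) p \<bullet> surface_normal (normal_surface \<alpha>) p)"
    using constant_angle_surface_square[OF assms(2)] by metis
  define B T where "B = (\<lambda>x. b x \<bullet> k)" and "T = (\<lambda>x. t x \<bullet> k)"
  have coeffs: "(B x)\<^sup>2 = c\<^sup>2 \<and> \<tau> x * (B x * T x) = 0 \<and> (\<tau> x)\<^sup>2 * (T x)\<^sup>2 = (\<tau> x)\<^sup>2 * c\<^sup>2"
    if x: "x \<in> I" for x
  proof -
    have "((B x)\<^sup>2 - c\<^sup>2) + (2 * c\<^sup>2 * \<kappa> x - 2 * B x * (\<kappa> x * B x + \<tau> x * T x)) * v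
        + ((\<kappa> x * B x + \<tau> x * T x)\<^sup>2 - c\<^sup>2 * ((\<kappa> x)\<^sup>2 + (\<tau> x)\<^sup>2)) * v\<^sup>2 = 0" if "v \<in> J" for v
    proof -
      have "((1 - v * \<kappa> x) * B x - v * \<tau> x * T x)\<^sup>2 = c\<^sup>2 * ((1 - v * \<kappa> x)\<^sup>2 + (v * \<tau> x)\<^sup>2)"
        using sq[of "(x, v)"] x that
        by (simp add: surface_normal_normal_surface inner_diff_left inner_diff_right
            frame_inner[OF x] B_def T_def power2_eq_square)
      then show ?thesis by (simp add: algebra_simps power2_eq_square)
    qed
    from quadratic_eq_0_on_open[of J, OF _ _ this]
    \<comment> \<open>The linear and quadratic coefficients simplify once \<open>B\<^sup>2 = c\<^sup>2\<close> cancels the terms in \<open>\<kappa>\<close>.\<close>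
    have raw: "(B x)\<^sup>2 = c\<^sup>2" "c\<^sup>2 * \<kappa> x = B x * (\<kappa> x * B x + \<tau> x * T x)"
      "(\<kappa> x * B x + \<tau> x * T x)\<^sup>2 = c\<^sup>2 * ((\<kappa> x)\<^sup>2 + (\<tau> x)\<^sup>2)"
      using J by (simp_all add: open_interval_def)
    have "B x * (\<kappa> x * B x + \<tau> x * T x) = (B x)\<^sup>2 * \<kappa> x + \<tau> x * (B x * T x)"
      by (simp add: algebra_simps power2_eq_square)
    then have BT: "\<tau> x * (B x * T x) = 0"
      using raw(1,2) by simp
    have "(\<kappa> x * B x + \<tau> x * T x)\<^sup>2
        = (\<kappa> x)\<^sup>2 * (B x)\<^sup>2 + 2 * \<kappa> x * (\<tau> x * (B x * T x)) + (\<tau> x)\<^sup>2 * (T x)\<^sup>2"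
      by (simp add: algebra_simps power2_eq_square)
    then have "(\<tau> x)\<^sup>2 * (T x)\<^sup>2 = (\<tau> x)\<^sup>2 * c\<^sup>2"
      unfolding BT raw(3) using raw(1) by (auto simp: algebra_simps)
    then show ?thesis using raw(1) BT by blast
  qed
  have BT: "B s * T s = 0" and TT: "(T s)\<^sup>2 = c\<^sup>2"
    using coeffs[OF s] torsion by auto
  \<comment> \<open>Both factors of a vanishing product have square \<open>c\<^sup>2\<close>.\<close>
  have c: "c = 0"
    using BT TT coeffs[OF s] by auto
  have B0: "b x \<bullet> k = 0" if "x \<in> I" for x
    using coeffs[OF that] c by (simp add: B_def)
  have "\<tau> s * (n s \<bullet> k) = 0"
    using inner_constant_derivative[OF open_I s binormal_derivative[OF s]
        has_vector_derivative_const B0] by simp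
  then show False
    using not_orthogonal_to_frame[OF s k] torsion TT c B0[OF s] by (simp add: T_def)
qed

text \<open>The same argument with \<open>n\<close> in place of \<open>b\<close>: now \<open>n \<bullet> k\<close> vanishes along the curve, and
  \<open>n' = - \<kappa> t + \<tau> b\<close> together with \<open>t \<bullet> k = 0\<close> makes \<open>b\<close> orthogonal to \<open>k\<close>.\<close>
lemma binormal_surface_torsion_free:
  assumes J: "open_interval J" and "constant_angle_surface I J (binormal_surface \<alpha>)" and s: "s \<in> I"
  shows "\<tau> s = 0"
proof (rule ccontr)
  assume torsion: "\<tau> s \<noteq> 0"
  obtain k c where k: "norm k = 1"
    and sq: "\<And>p. p \<in> I \<times> J \<Longrightarrow> (surface_normal (binormal_surface \<alpha>) p \<bullet> k)\<^sup>2
      = c\<^sup>2 * (surface_normal (binormal_surface \<alpha>) p \<bullet> surface_normal (binormal_surface \<alpha>) p)"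
    using constant_angle_surface_square[OF assms(2)] by metis
  define P T where "P = (\<lambda>x. n x \<bullet> k)" and "T = (\<lambda>x. t x \<bullet> k)"
  have coeffs: "(P x)\<^sup>2 = c\<^sup>2 \<and> \<tau> x * (P x * T x) = 0 \<and> (\<tau> x)\<^sup>2 * (T x)\<^sup>2 = (\<tau> x)\<^sup>2 * c\<^sup>2"
    if x: "x \<in> I" for x
  proof -
    have "((P x)\<^sup>2 - c\<^sup>2) + (2 * (\<tau> x * (P x * T x))) * v
        + ((\<tau> x)\<^sup>2 * (T x)\<^sup>2 - (\<tau> x)\<^sup>2 * c\<^sup>2) * v\<^sup>2 = 0" if "v \<in> J" for v
    proof -
      have "(- P x - v * \<tau> x * T x)\<^sup>2 = c\<^sup>2 * (1 + (v * \<tau> x)\<^sup>2)"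
        using sq[of "(x, v)"] x that
        by (simp add: surface_normal_binormal_surface inner_diff_left inner_diff_right
            frame_inner[OF x] P_def T_def power2_eq_square)
      then show ?thesis by (simp add: algebra_simps power2_eq_square)
    qed
    from quadratic_eq_0_on_open[of J, OF _ _ this] show ?thesis
      using J by (simp add: open_interval_def)
  qed
  have PT: "P s * T s = 0" and TT: "(T s)\<^sup>2 = c\<^sup>2"
    using coeffs[OF s] torsion by auto
  \<comment> \<open>Both factors of a vanishing product have square \<open>c\<^sup>2\<close>.\<close>
  have c: "c = 0"
    using PT TT coeffs[OF s] by auto
  have P0: "n x \<bullet> k = 0" if "x \<in> I" for x
    using coeffs[OF that] c by (simp add: P_def)
  have T0: "t s \<bullet> k = 0" using TT c by (simp add: T_def)
  have "\<tau> s * (b s \<bullet> k) = 0"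
    using inner_constant_derivative[OF open_I s normal_derivative[OF s]
        has_vector_derivative_const P0] T0 by (simp add: inner_add_left inner_diff_left)
  then show False
    using not_orthogonal_to_frame[OF s k T0 P0[OF s]] torsion by simp
qed

section \<open>Surfaces of torsion free curves\<close>

lemma piece_of_plane_normal_surface:
  assumes torsion_free: "\<And>s. s \<in> I \<Longrightarrow> \<tau> s = 0"
  shows "piece_of_plane I J (normal_surface \<alpha>)"
proof -
  obtain s0 where s0: "s0 \<in> I" using nonempty_I by blast
  have b: "b s = b s0" if "s \<in> I" for s
    using binormal_constant_if_torsion_free[OF torsion_free that s0] .
  have "((\<lambda>s. b s0 \<bullet> \<alpha> s) has_vector_derivative 0) (at s)" if "s \<in> I" for s
    using bounded_linear.has_vector_derivative[OF bounded_linear_inner_right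
        curve_derivative[OF that], of "b s0"] frame_inner(7)[OF that] b[OF that] by simp
  then have \<alpha>: "b s0 \<bullet> \<alpha> s = b s0 \<bullet> \<alpha> s0" if "s \<in> I" for s
    using has_vector_derivative_zero_constant_on[of I "\<lambda>s. b s0 \<bullet> \<alpha> s", OF interval_I _ that s0]
    by simp
  have n: "b s0 \<bullet> n s = 0" if "s \<in> I" for s
    using frame_inner(9)[OF that] b[OF that] by simp
  have "b s0 \<noteq> 0" using frame_inner(3)[OF s0] by auto
  moreover have "normal_surface \<alpha> ` (I \<times> J) \<subseteq> {x. b s0 \<bullet> x = b s0 \<bullet> \<alpha> s0}"
    using \<alpha> n by (auto simp: normal_surface_def inner_add_right)
  ultimately show ?thesis unfolding piece_of_plane_def by blast
qed

text \<open>Coordinates in the frame at one fixed parameter \<open>s0\<close> turn the constant direction \<open>b\<close> into the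
  vertical axis and \<open>\<alpha>\<close> into a curve over its projection \<open>\<beta>\<close>. The projection is regular because \<open>\<alpha>'\<close>
  is a unit vector orthogonal to \<open>b\<close>, so that nothing of it is lost.\<close>
lemma piece_of_cylindrical_surface_binormal_surface:
  assumes torsion_free: "\<And>s. s \<in> I \<Longrightarrow> \<tau> s = 0"
  shows "piece_of_cylindrical_surface I J (binormal_surface \<alpha>)"
proof -
  obtain s0 where s0: "s0 \<in> I" using nonempty_I by blast
  have b: "b s = b s0" if "s \<in> I" for s
    using binormal_constant_if_torsion_free[OF torsion_free that s0] .
  interpret F: orthonormal_frame "t s0" "n s0" "b s0" using frame[OF s0] .
  define proj :: "real^3 \<Rightarrow> real^2" where "proj = (\<lambda>x. vector [t s0 \<bullet> x, n s0 \<bullet> x])"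
  define \<beta> where "\<beta> = (\<lambda>s. proj (\<alpha> s))"
  have "linear proj"
    by (rule linearI) (simp_all add: proj_def vec_eq_iff forall_2 inner_add_right)
  then have proj: "bounded_linear proj" by (simp add: linear_conv_bounded_linear)
  have "velocity \<beta> s \<noteq> 0" if s: "s \<in> I" for s
  proof
    assume "velocity \<beta> s = 0"
    moreover have "velocity \<beta> s = proj (t s)"
      unfolding velocity_def \<beta>_def
      using bounded_linear.has_vector_derivative[OF proj curve_derivative[OF s]]
      by (rule vector_derivative_at)
    ultimately have "t s0 \<bullet> t s = 0" "n s0 \<bullet> t s = 0"
      by (simp_all add: proj_def vec_eq_iff forall_2)
    moreover have "b s0 \<bullet> t s = 0" using frame_inner(7)[OF s] b[OF s] by simp
    ultimately have "t s = 0" by (rule F.eq_0_if_orthogonal)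
    then show False using frame_inner(1)[OF s] by simp
  qed
  then have regular: "regular_plane_curve I \<beta>"
    unfolding regular_plane_curve_def
    using I smooth_on_bounded_linear_compose[OF open_I proj smooth] by (simp add: \<beta>_def)
  have ruling: "F.coordinates (binormal_surface \<alpha> (s, v)) \<in> vertical_line (\<beta> s)"
    if "s \<in> I" for s v
    using b[OF that]
    by (auto simp: F.coordinates_def binormal_surface_def vertical_line_def \<beta>_def proj_def
        inner_add_right F.frame_inner)
  have "F.coordinates ` binormal_surface \<alpha> ` (I \<times> J) \<subseteq> (\<Union>q \<in> \<beta> ` I. vertical_line q)"
    using ruling by fastforce
  moreover have "\<forall>s \<in> I. \<exists>q \<in> \<beta> ` I. \<forall>v \<in> J.
      F.coordinates (binormal_surface \<alpha> (s, v)) \<in> vertical_line q"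
    using ruling by blast
  ultimately show ?thesis
    unfolding piece_of_cylindrical_surface_def using F.isometry_coordinates regular by blast
qed

end

theorem theorem3:
  fixes I J :: "real set" and \<alpha> :: "real \<Rightarrow> real^3"
  assumes "open_interval I" and "open_interval J"
    and "smooth_on I \<alpha>"
    and "\<forall>s \<in> I. norm (velocity \<alpha> s) = 1"
    and "\<forall>s \<in> I. curvature \<alpha> s \<noteq> 0"
  shows "(regular_surface I J (normal_surface \<alpha>) \<and>
          constant_angle_surface I J (normal_surface \<alpha>) \<longrightarrow>
            piece_of_plane I J (normal_surface \<alpha>)) \<and>
         (constant_angle_surface I J (binormal_surface \<alpha>) \<longrightarrow>
            piece_of_cylindrical_surface I J (binormal_surface \<alpha>))"
proof -
  interpret frenet_curve I \<alpha> using assms by unfold_locales auto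
  show ?thesis
    using normal_surface_torsion_free[OF assms(2)] piece_of_plane_normal_surface
      binormal_surface_torsion_free[OF assms(2)] piece_of_cylindrical_surface_binormal_surface
    by blast
qed

end
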